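(* Let $X$ be a random variable on $\mathbb{S}^1$ with density $f\in\mathcal{L}^\infty(\mathbb{S}^1)\cap\dot{\mathcal{H}}^s(\mathbb{S}^1)$ for some $s>0$, and let $X_1,\dots,X_n$ be i.i.d. samples of $X$. Let $h=h_n=n^{-1/(2s+1)}$ and let $g$ be an $s$-admissible symbol. Let $-\pi<\vartheta_1<\vartheta_2\le\pi$ and $A[\vartheta_1,\vartheta_2]=\{x=x(\theta)\in\mathbb{S}^1:\vartheta_1\le\theta\le\vartheta_2\}$. Then the probability estimator $\widehat{\mathbb{P}}(A[\vartheta_1,\vartheta_2])=\int_{A[\vartheta_1,\vartheta_2]}\widehat f_s\,d\sigma_{\mathbb{S}^1}$ satisfies $$\widehat{\mathbb{P}}(A[\vartheta_1,\vartheta_2])=\frac{\vartheta_2-\vartheta_1}{2\pi}+\frac{1}{\pi n}\sum_{j=1}^n\sum_{\ell=1}^{N_s}\frac{g(h\ell)}{\ell}\Big(\sin(\ell(\vartheta_2-\theta_j))-\sin(\ell(\vartheta_1-\theta_j))\Big),$$ where $\theta_j\in(-\pi,\pi]$ is the polar angle of $X_j$, $j=1,\dots,n$.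
   Context: $\mathbb{S}^1=\{x\in\mathbb{R}^2:\|x\|=1\}$ with (unnormalized) length measure $\sigma_{\mathbb{S}^1}$. For $\theta\in(-\pi,\pi]$, $x(\theta)=(\cos\theta,\sin\theta)$ and $\theta$ is the polar angle of $x(\theta)$; $\int_{\mathbb{S}^1}F\,d\sigma_{\mathbb{S}^1}=\int_{-\pi}^{\pi}F(\cos\theta,\sin\theta)\,d\theta$. $\rho_{\mathbb{S}^1}(x,y)=\arccos\langle x,y\rangle$ and $L_{\mathbb{S}^1}=-d^2/d\theta^2$, with its usual (spectral) fractional powers. Convention: for $t>0$, $\lfloor t\rfloor$ denotes the largest integer strictly smaller than $t$. Hölder space: $f\in\dot{\mathcal{H}}^s(\mathbb{S}^1)$ means $\sup_{x\ne y}|L_{\mathbb{S}^1}^{k/2}f(x)-L_{\mathbb{S}^1}^{k/2}f(y)|/\rho_{\mathbb{S}^1}(x,y)^{s-k}<\infty$, where $k$ is the largest integer strictly less than $s$. $s$-admissible symbol (here $d=1$): an even measurable $g:\mathbb{R}\to\mathbb{R}$ in $\mathcal{C}^\tau(\mathbb{R})$ for some $\tau\in\mathbb{N}$, $\tau>1+s$, with $g(0)=1$, $g^{(\nu)}(0)=0$ for $1\le\nu\le\tau$, and constants $r>\tau+1$, $C_\tau>0$ with $|g^{(\nu)}(\lambda)|\le C_\tau(1+|\lambda|)^{-r}$ for all $\lambda\in\mathbb{R}$, $0\le\nu\le\tau$. Finite-order estimator: with $N_s:=\big\lfloor(\pi(r-1))^{-\frac1{r-1}}\,n^{\frac{s+r}{(2s+1)(r-1)}}\big\rfloor+1$,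 $$\widehat f_s(x)=\frac{1}{2\pi n}\sum_{j=1}^n\Big(1+2\sum_{\ell=1}^{N_s}g(h\ell)\cos(\ell(\theta-\theta_j))\Big),\quad x=x(\theta)\in\mathbb{S}^1.$$ *)

theory Defs
  imports "HOL-Probability.Probability"
begin

definition circle :: "(real^2) set" where
  "circle = sphere 0 1"

definition circle_point :: "real \<Rightarrow> real^2" where
  "circle_point \<theta> = vector [cos \<theta>, sin \<theta>]"

definition polar_angle :: "real^2 \<Rightarrow> real" where
  "polar_angle x = (THE \<theta>. \<theta> \<in> {-pi<..pi} \<and> circle_point \<theta> = x)"

text \<open>Unnormalized length measure: the image of Lebesgue measure on \<open>(-\<pi>, \<pi>]\<close>, of total mass \<open>2\<pi>\<close>.
  Its underlying space is the circle itself, not the whole plane.\<close>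

definition circle_measure :: "(real^2) measure" where
  "circle_measure =
     distr (restrict_space lborel {-pi<..pi}) (restrict_space borel circle) circle_point"

definition circle_dist :: "real^2 \<Rightarrow> real^2 \<Rightarrow> real" where
  "circle_dist x y = arccos (x \<bullet> y)"

definition circle_arc :: "real \<Rightarrow> real \<Rightarrow> (real^2) set" where
  "circle_arc a b = {circle_point \<theta> | \<theta>. a \<le> \<theta> \<and> \<theta> \<le> b}"

lemma circle_point_in_circle: "circle_point \<theta> \<in> circle"
  by (simp add: circle_def circle_point_def norm_vec_def L2_set_def sum_2 vector_2)

lemma polar_angle_ex1:
  assumes "x \<in> circle"
  shows "\<exists>!\<theta>. \<theta> \<in> {-pi<..pi} \<and> circle_point \<theta> = x"
proof -
  have n: "(x$1)\<^sup>2 + (x$2)\<^sup>2 = 1"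
    using assms by (simp add: circle_def norm_vec_def L2_set_def sum_2)
  define z where "z = Complex (x$1) (x$2)"
  have nz: "norm z = 1" using n by (simp add: z_def cmod_def)
  have nz0: "z \<noteq> 0" using nz by auto
  have cp: "circle_point \<theta> = x \<longleftrightarrow> cis \<theta> = z" for \<theta>
    by (auto simp: circle_point_def vec_eq_iff forall_2 z_def complex_eq_iff vector_2)
  have sg: "sgn z = z" using nz by (simp add: sgn_div_norm)
  show ?thesis
  proof (rule ex1I[of _ "Arg z"])
    show "Arg z \<in> {-pi<..pi} \<and> circle_point (Arg z) = x"
      using nz nz0 cis_Arg[OF nz0] sg Arg_bounded[of z] by (auto simp: cp)
  next
    fix \<theta> assume a: "\<theta> \<in> {-pi<..pi} \<and> circle_point \<theta> = x"
    then have "cis \<theta> = sgn z" using sg by (simp add: cp)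
    then show "\<theta> = Arg z"
      using cis_Arg_unique[of z \<theta>] a by auto
  qed
qed

lemma circle_point_polar_angle:
  assumes "x \<in> circle"
  shows "polar_angle x \<in> {-pi<..pi}" "circle_point (polar_angle x) = x"
  using theI'[OF polar_angle_ex1[OF assms]] by (auto simp: polar_angle_def)

lemma circle_point_measurable [measurable]:
  "circle_point \<in> restrict_space lborel {-pi<..pi} \<rightarrow>\<^sub>M restrict_space borel circle"
proof -
  have "circle_point = (\<lambda>\<theta>. cos \<theta> *\<^sub>R axis 1 1 + sin \<theta> *\<^sub>R axis 2 1)"
    by (auto simp: circle_point_def vec_eq_iff forall_2 vector_2 axis_def)
  moreover have "(\<lambda>\<theta>. cos \<theta> *\<^sub>R axis 1 1 + sin \<theta> *\<^sub>R axis 2 1 :: real^2) \<in> borel_measurable borel"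
    by (auto intro!: borel_measurable_continuous_onI continuous_intros)
  ultimately have "circle_point \<in> borel_measurable borel" by simp
  then show ?thesis
    by (intro measurable_restrict_space2) (auto simp: circle_point_in_circle measurable_restrict_space1)
qed

lemma integral_circle_measure:
  fixes F :: "real^2 \<Rightarrow> real"
  assumes "F \<in> borel_measurable circle_measure"
  shows "(\<integral>x. F x \<partial>circle_measure) = (LINT \<theta>:{-pi<..pi}|lborel. F (circle_point \<theta>))"
  using assms
  by (simp add: circle_measure_def integral_distr integral_restrict_space set_lebesgue_integral_def)

definition circle_fourier :: "(real^2 \<Rightarrow> real) \<Rightarrow> int \<Rightarrow> complex" where
  "circle_fourier f m =
     (LINT \<theta>:{-pi<..pi}|lborel. complex_of_real (f (circle_point \<theta>)) * cis (- (of_int m * \<theta>)))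
       / complex_of_real (2 * pi)"

definition circle_square_integrable :: "(real^2 \<Rightarrow> real) \<Rightarrow> bool" where
  "circle_square_integrable f \<longleftrightarrow>
     f \<in> borel_measurable circle_measure \<and> integrable circle_measure (\<lambda>x. (f x)\<^sup>2)"

text \<open>The exponential \<open>cis (m \<theta>)\<close> is an eigenfunction of \<open>L = -d\<^sup>2/d\<theta>\<^sup>2\<close> with eigenvalue \<open>m\<^sup>2\<close>.\<close>

definition circle_eigenvalue :: "int \<Rightarrow> real" where
  "circle_eigenvalue m = (real_of_int m)\<^sup>2"

lemma circle_eigenvalue_eigenfunction:
  obtains D where
    "\<And>\<theta>. ((\<lambda>t. cis (of_int m * t)) has_vector_derivative D \<theta>) (at \<theta>)"
    "\<And>\<theta>. (D has_vector_derivative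
        - (complex_of_real (circle_eigenvalue m) * cis (of_int m * \<theta>))) (at \<theta>)"
proof
  have c: "((\<lambda>t. cis (of_int m * t)) has_vector_derivative
      \<i> * of_int m * cis (of_int m * \<theta>)) (at \<theta>)" for \<theta> :: real
  proof -
    have "((\<lambda>t. exp (t *\<^sub>R (\<i> * of_int m))) has_vector_derivative
        exp (\<theta> *\<^sub>R (\<i> * of_int m)) * (\<i> * of_int m)) (at \<theta>)"
      by (rule exp_scaleR_has_vector_derivative_right)
    then show ?thesis
      by (simp add: cis_conv_exp scaleR_conv_of_real mult_ac)
  qed
  show "((\<lambda>t. cis (of_int m * t)) has_vector_derivative
      \<i> * of_int m * cis (of_int m * \<theta>)) (at \<theta>)" for \<theta> :: real by (rule c)
  show "((\<lambda>\<theta>. \<i> * of_int m * cis (of_int m * \<theta>)) has_vector_derivative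
        - (complex_of_real (circle_eigenvalue m) * cis (of_int m * \<theta>))) (at \<theta>)" for \<theta> :: real
    using has_vector_derivative_mult_right[OF c, of "\<i> * of_int m" \<theta>]
    by (simp add: circle_eigenvalue_def power2_eq_square algebra_simps)
qed

text \<open>\<open>F\<close> is (a version of) \<open>L\<^sup>\<alpha> f\<close>, in the sense of the spectral theorem on square-integrable
  functions, for \<open>\<alpha> \<ge> 0\<close>. The case \<open>\<alpha> = 0\<close> is separated because \<open>L\<^sup>0\<close> is the identity while
  \<open>0 powr 0 = 0\<close>.\<close>

definition laplace_power :: "real \<Rightarrow> (real^2 \<Rightarrow> real) \<Rightarrow> (real^2 \<Rightarrow> real) \<Rightarrow> bool" where
  "laplace_power \<alpha> f F \<longleftrightarrow>
     circle_square_integrable f \<and> circle_square_integrable F \<and>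
     (\<forall>m. circle_fourier F m =
        complex_of_real (if \<alpha> = 0 then 1 else circle_eigenvalue m powr \<alpha>) * circle_fourier f m)"

text \<open>Largest integer strictly smaller than \<open>t\<close>; differs from \<open>floor\<close> at integers.\<close>

definition strict_floor :: "real \<Rightarrow> int" where
  "strict_floor t = (GREATEST k. of_int k < t)"

lemma strict_floor_eq: "strict_floor t = \<lceil>t\<rceil> - 1"
  unfolding strict_floor_def by (rule Greatest_equality) linarith+

definition circle_holder :: "real \<Rightarrow> (real^2 \<Rightarrow> real) set" where
  "circle_holder s = {f. \<exists>F. laplace_power (of_int (strict_floor s) / 2) f F \<and>
     bdd_above {\<bar>F x - F y\<bar> / circle_dist x y powr (s - of_int (strict_floor s)) | x y.
       x \<in> circle \<and> y \<in> circle \<and> x \<noteq> y}}"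

definition circle_Linf :: "(real^2 \<Rightarrow> real) set" where
  "circle_Linf = {f. f \<in> borel_measurable circle_measure \<and>
     esssup circle_measure (\<lambda>x. ereal \<bar>f x\<bar>) < \<infinity>}"

definition C_diff :: "nat \<Rightarrow> (real \<Rightarrow> real) \<Rightarrow> bool" where
  "C_diff k g \<longleftrightarrow> (\<forall>i<k. \<forall>x. (deriv ^^ i) g differentiable at x) \<and> continuous_on UNIV ((deriv ^^ k) g)"

definition admissible_symbol :: "real \<Rightarrow> nat \<Rightarrow> real \<Rightarrow> (real \<Rightarrow> real) \<Rightarrow> bool" where
  "admissible_symbol s \<tau> r g \<longleftrightarrow>
     g \<in> borel_measurable borel \<and> (\<forall>u. g (- u) = g u) \<and>
     real \<tau> > 1 + s \<and> C_diff \<tau> g \<and>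
     g 0 = 1 \<and> (\<forall>\<nu>\<in>{1..\<tau>}. (deriv ^^ \<nu>) g 0 = 0) \<and>
     r > real \<tau> + 1 \<and>
     (\<exists>C>0. \<forall>u. \<forall>\<nu>\<le>\<tau>. \<bar>(deriv ^^ \<nu>) g u\<bar> \<le> C * (1 + \<bar>u\<bar>) powr (- r))"

definition bandwidth :: "real \<Rightarrow> nat \<Rightarrow> real" where
  "bandwidth s n = real n powr (- 1 / (2 * s + 1))"

definition trunc_order :: "real \<Rightarrow> real \<Rightarrow> nat \<Rightarrow> nat" where
  "trunc_order s r n =
     nat (strict_floor ((pi * (r - 1)) powr (- 1 / (r - 1))
            * real n powr ((s + r) / ((2 * s + 1) * (r - 1)))) + 1)"

definition density_estimator ::
    "real \<Rightarrow> real \<Rightarrow> (real \<Rightarrow> real) \<Rightarrow> nat \<Rightarrow> (nat \<Rightarrow> real^2) \<Rightarrow> real^2 \<Rightarrow> real" where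
  "density_estimator s r g n xs x =
     1 / (2 * pi * real n) * (\<Sum>j=1..n. 1 + 2 * (\<Sum>l=1..trunc_order s r n.
        g (bandwidth s n * real l) * cos (real l * (polar_angle x - polar_angle (xs j)))))"

definition prob_estimator ::
    "real \<Rightarrow> real \<Rightarrow> (real \<Rightarrow> real) \<Rightarrow> nat \<Rightarrow> (nat \<Rightarrow> real^2) \<Rightarrow> (real^2) set \<Rightarrow> real" where
  "prob_estimator s r g n xs A = (LINT x:A|circle_measure. density_estimator s r g n xs x)"

end

theory Submission
  imports Defs
begin

text \<open>For each fixed outcome the estimator is a trigonometric polynomial in the polar angle, and
  the identity comes from integrating it term by term. As \<open>-\<pi> < \<theta>1\<close> and \<open>\<theta>2 \<le> \<pi>\<close>, the arc does not wrap around
  the cut of the polar angle, so in the coordinate \<open>\<theta> \<in> (-\<pi>, \<pi>]\<close> it is exactly the interval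
  \<open>[\<theta>1, \<theta>2]\<close>, and the length measure becomes Lebesgue measure on that interval
  (\<open>set_integral_circle_arc\<close>). There the integrand is a finite combination of the constant \<open>1\<close>
  and the functions \<open>cos (l (\<theta> - \<theta>\<^sub>j))\<close>, whose primitives are \<open>\<theta>\<close> and \<open>sin (l (\<theta> - \<theta>\<^sub>j)) / l\<close>.

  The change of variables needs measurability of the integrand on the circle, although the polar
  angle jumps at the point of angle \<open>\<pi>\<close>. For an integer frequency
  \<open>l\<close> the jump is invisible: at \<open>z = cis \<theta>\<close>, \<open>cos (l (\<theta> - a))\<close> equals the real part of
  \<open>z\<^sup>l cis (- l a)\<close>, which is continuous in \<open>z\<close> on the whole plane (\<open>cos_polar_angle_eq\<close>).\<close>

lemma space_circle_measure [simp]: "space circle_measure = circle"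
  by (simp add: circle_measure_def space_restrict_space)

lemma sets_circle_measure [measurable_cong]:
  "sets circle_measure = sets (restrict_space borel circle)"
  by (simp add: circle_measure_def)

lemma polar_angle_circle_point:
  assumes "\<theta> \<in> {-pi<..pi}"
  shows "polar_angle (circle_point \<theta>) = \<theta>"
  using polar_angle_ex1[OF circle_point_in_circle[of \<theta>]]
    circle_point_polar_angle[OF circle_point_in_circle[of \<theta>]] assms
  by blast

text \<open>Both \<open>\<theta>\<close> and \<open>[a, b]\<close> lie in the fundamental domain \<open>(-\<pi>, \<pi>]\<close>, on which \<open>circle_point\<close> is
  injective. With \<open>a = -\<pi> \<le> b < \<pi>\<close> the equivalence fails for \<open>\<theta> = \<pi>\<close>, the angle of the
  starting point of the arc.\<close>

lemma circle_point_mem_circle_arc_iff: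
  assumes "- pi < a" "b \<le> pi" "\<theta> \<in> {-pi<..pi}"
  shows "circle_point \<theta> \<in> circle_arc a b \<longleftrightarrow> \<theta> \<in> {a..b}"
proof
  assume "circle_point \<theta> \<in> circle_arc a b"
  then obtain \<phi> where \<phi>: "a \<le> \<phi>" "\<phi> \<le> b" "circle_point \<theta> = circle_point \<phi>"
    by (auto simp: circle_arc_def)
  then have "\<phi> = polar_angle (circle_point \<phi>)"
    using assms by (simp add: polar_angle_circle_point)
  also have "\<dots> = \<theta>"
    using \<phi>(3) assms(3) by (metis polar_angle_circle_point)
  finally show "\<theta> \<in> {a..b}"
    using \<phi> by simp
qed (auto simp: circle_arc_def)

lemma continuous_on_circle_point: "continuous_on A circle_point"
proof -
  have eq: "circle_point = (\<lambda>\<theta>. cos \<theta> *\<^sub>R axis 1 1 + sin \<theta> *\<^sub>R axis 2 1)"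
    by (auto simp: circle_point_def vec_eq_iff forall_2 vector_2 axis_def)
  show ?thesis
    unfolding eq by (intro continuous_intros)
qed

lemma circle_arc_measurable: "circle_arc a b \<in> sets circle_measure"
proof -
  have eq: "circle_arc a b = circle_point ` {a..b}"
    by (auto simp: circle_arc_def)
  have "compact (circle_arc a b)"
    unfolding eq by (intro compact_continuous_image continuous_on_circle_point compact_Icc)
  moreover have "circle_arc a b \<subseteq> circle"
    by (auto simp: circle_arc_def circle_point_in_circle)
  ultimately show ?thesis
    by (auto simp: sets_circle_measure sets_restrict_space compact_imp_closed intro!: image_eqI)
qed

lemma set_integral_circle_arc:
  fixes F :: "real^2 \<Rightarrow> real"
  assumes "F \<in> borel_measurable circle_measure" "- pi < a" "b \<le> pi"
  shows "(LINT x:circle_arc a b|circle_measure. F x) = (LINT \<theta>:{a..b}|lborel. F (circle_point \<theta>))"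
proof -
  have "(LINT x:circle_arc a b|circle_measure. F x) =
      (LINT \<theta>:{-pi<..pi}|lborel. indicator (circle_arc a b) (circle_point \<theta>) * F (circle_point \<theta>))"
    unfolding set_lebesgue_integral_def[of circle_measure] using assms(1) circle_arc_measurable
    by (subst integral_circle_measure) auto
  also have "\<dots> = (LINT \<theta>:{a..b}|lborel. F (circle_point \<theta>))"
    unfolding set_lebesgue_integral_def
    using circle_point_mem_circle_arc_iff[OF assms(2,3)] assms(2,3)
    by (intro Bochner_Integration.integral_cong) (auto simp: indicator_def)
  finally show ?thesis .
qed

text \<open>De Moivre's formula trades the discontinuous polar angle for a polynomial in the coordinates
  of \<open>x\<close>; this is where the frequency has to be an integer.\<close>

lemma cos_polar_angle_eq:
  assumes "x \<in> circle"
  shows "cos (real l * (polar_angle x - a)) = Re (Complex (x$1) (x$2) ^ l * cis (- (real l * a)))"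
proof -
  have "circle_point (polar_angle x) = x"
    using assms by (rule circle_point_polar_angle)
  then have "Complex (x$1) (x$2) = cis (polar_angle x)"
    by (metis circle_point_def vector_2 cis.code)
  then have "Complex (x$1) (x$2) ^ l * cis (- (real l * a)) = cis (real l * (polar_angle x - a))"
    by (simp add: Complex.DeMoivre cis_mult right_diff_distrib)
  then show ?thesis by simp
qed

lemma cos_polar_angle_measurable [measurable]:
  "(\<lambda>x. cos (real l * (polar_angle x - a))) \<in> borel_measurable circle_measure"
proof -
  have "(\<lambda>x::real^2. Re (Complex (x$1) (x$2) ^ l * cis (- (real l * a)))) \<in> borel_measurable borel"
    unfolding Complex_eq by (intro borel_measurable_continuous_onI continuous_intros)
  then have "(\<lambda>x::real^2. Re (Complex (x$1) (x$2) ^ l * cis (- (real l * a))))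
      \<in> borel_measurable circle_measure"
    unfolding measurable_cong_sets[OF sets_circle_measure refl] by (rule measurable_restrict_space1)
  then show ?thesis
    by (rule measurable_cong[THEN iffD1, rotated]) (simp add: cos_polar_angle_eq)
qed

lemma density_estimator_measurable [measurable]:
  "density_estimator s r g n xs \<in> borel_measurable circle_measure"
  unfolding density_estimator_def by measurable

lemma set_integral_cos_sum:
  fixes \<alpha> :: "'i \<Rightarrow> real" and c :: "nat \<Rightarrow> real"
  assumes "a \<le> b"
  shows "(LINT \<theta>:{a..b}|lborel. \<Sum>j\<in>J. 1 + 2 * (\<Sum>l=1..N. c l * cos (real l * (\<theta> - \<alpha> j)))) =
    real (card J) * (b - a) +
    2 * (\<Sum>j\<in>J. \<Sum>l=1..N. c l / real l * (sin (real l * (b - \<alpha> j)) - sin (real l * (a - \<alpha> j))))"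
proof -
  define P where "P t = (\<Sum>j\<in>J. t + 2 * (\<Sum>l=1..N. c l / real l * sin (real l * (t - \<alpha> j))))" for t
  have "(LINT \<theta>:{a..b}|lborel. \<Sum>j\<in>J. 1 + 2 * (\<Sum>l=1..N. c l * cos (real l * (\<theta> - \<alpha> j)))) = P b - P a"
    unfolding set_lebesgue_integral_def
  proof (rule integral_FTC_Icc[OF assms])
    show "(P has_vector_derivative (\<Sum>j\<in>J. 1 + 2 * (\<Sum>l=1..N. c l * cos (real l * (t - \<alpha> j)))))
        (at t within {a..b})" for t
      unfolding P_def has_real_derivative_iff_has_vector_derivative[symmetric]
      by (auto intro!: derivative_eq_intros sum.cong)
  qed (intro continuous_intros)
  also have "\<dots> = real (card J) * (b - a) +
    2 * (\<Sum>j\<in>J. \<Sum>l=1..N. c l / real l * (sin (real l * (b - \<alpha> j)) - sin (real l * (a - \<alpha> j))))"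
    by (simp add: P_def sum.distrib sum_subtractf sum_distrib_left right_diff_distrib)
  finally show ?thesis .
qed

theorem proposition4p2:
  fixes M :: "'a measure"
    and X :: "'a \<Rightarrow> real^2"
    and Xs :: "nat \<Rightarrow> 'a \<Rightarrow> real^2"
    and f :: "real^2 \<Rightarrow> real"
    and g :: "real \<Rightarrow> real"
    and s r \<theta>1 \<theta>2 :: real
    and n \<tau> :: nat
  assumes "prob_space M"
    and "s > 0"
    and "f \<in> circle_Linf \<inter> circle_holder s"
    and "AE x in circle_measure. 0 \<le> f x"
    and "distributed M circle_measure X (\<lambda>x. ennreal (f x))"
    and "n \<ge> 1"
    and "prob_space.indep_vars M (\<lambda>_. circle_measure) Xs {1..n}"
    and "\<And>j. j \<in> {1..n} \<Longrightarrow> distr M circle_measure (Xs j) = distr M circle_measure X"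
    and "admissible_symbol s \<tau> r g"
    and "- pi < \<theta>1" and "\<theta>1 < \<theta>2" and "\<theta>2 \<le> pi"
  shows "\<forall>\<omega>\<in>space M.
    prob_estimator s r g n (\<lambda>j. Xs j \<omega>) (circle_arc \<theta>1 \<theta>2) =
      (\<theta>2 - \<theta>1) / (2 * pi) +
      1 / (pi * real n) * (\<Sum>j=1..n. \<Sum>l=1..trunc_order s r n.
        g (bandwidth s n * real l) / real l *
          (sin (real l * (\<theta>2 - polar_angle (Xs j \<omega>))) - sin (real l * (\<theta>1 - polar_angle (Xs j \<omega>)))))"
proof
  fix \<omega>
  let ?N = "trunc_order s r n" and ?h = "bandwidth s n"
  let ?\<alpha> = "\<lambda>j. polar_angle (Xs j \<omega>)"
  let ?S = "\<Sum>j=1..n. \<Sum>l=1..?N. g (?h * real l) / real l *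
    (sin (real l * (\<theta>2 - ?\<alpha> j)) - sin (real l * (\<theta>1 - ?\<alpha> j)))"
  have "prob_estimator s r g n (\<lambda>j. Xs j \<omega>) (circle_arc \<theta>1 \<theta>2) =
      (LINT \<theta>:{\<theta>1..\<theta>2}|lborel. density_estimator s r g n (\<lambda>j. Xs j \<omega>) (circle_point \<theta>))"
    unfolding prob_estimator_def using assms(10,12)
    by (intro set_integral_circle_arc density_estimator_measurable)
  also have "\<dots> = (LINT \<theta>:{\<theta>1..\<theta>2}|lborel. 1 / (2 * pi * real n) *
      (\<Sum>j=1..n. 1 + 2 * (\<Sum>l=1..?N. g (?h * real l) * cos (real l * (\<theta> - ?\<alpha> j)))))"
    using assms(10,12)
    by (intro set_lebesgue_integral_cong) (auto simp: density_estimator_def polar_angle_circle_point)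
  also have "\<dots> = 1 / (2 * pi * real n) * (real n * (\<theta>2 - \<theta>1) + 2 * ?S)"
    unfolding set_integral_mult_right using assms(11) by (subst set_integral_cos_sum) auto
  also have "\<dots> = (\<theta>2 - \<theta>1) / (2 * pi) + 1 / (pi * real n) * ?S"
    using assms(6) by (simp add: field_simps)
  finally show "prob_estimator s r g n (\<lambda>j. Xs j \<omega>) (circle_arc \<theta>1 \<theta>2) =
      (\<theta>2 - \<theta>1) / (2 * pi) + 1 / (pi * real n) * ?S" .
qed

end
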